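(* For any $k,n\in\mathbb{N}$ (with $k,n\ge 1$) and any $t\in(-k,-k+1)$, $$\lim_{\substack{z\to t\\ \Im z>0}}\log G_n(z)=\log|G_n(t)|+i(-1)^n\pi\,\frac{(k)_n}{n!},$$ where $(k)_n=k(k+1)(k+2)\cdots(k+n-1)$ is the Pochhammer symbol.
   Context: $G_n$ ($n\ge1$) is the (Barnes) multiple Gamma function of order $n$: with $G_0(z)=z$, the $G_n$ are the unique meromorphic functions on $\mathbb{C}$ such that (1) $G_n(z+1)=G_{n-1}(z)G_n(z)$, (2) $G_n(1)=1$, (3) on $x\ge 1$, $G_n$ is infinitely differentiable and $\frac{d^{n+1}}{dx^{n+1}}\log G_n(x)\ge 0$. In particular $G_1=\Gamma$ is Euler's Gamma function and $G_2$ is the Barnes $G$-function. $G_n$ is positive on $(0,\infty)$ and its only zeros or poles are at $0,-1,-2,\ldots$. $\log G_n$ denotes the holomorphic branch on $\mathbb{C}\setminus(-\infty,0]$ that is real on $(0,\infty)$. *)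

theory Defs
  imports "HOL-Complex_Analysis.Complex_Analysis"
begin

(* The sequence of (Barnes) multiple Gamma functions, given by its characterisation.

   - A meromorphic function is represented by a total function via nicely_meromorphic_on:
     it takes the value 0 at its poles and equals its limit at every other point.
   - The functional equation is one of meromorphic functions, so it is required to hold off a
     discrete set only.  Pointwise it would be false at poles because of the value 0 there,
     e.g. Gamma (0 + 1) = 0 * Gamma 0.
   - The convexity condition involves the real logarithm of G n on [1, \<infinity>), so it includes
     that G n is real and positive there.  Derivatives at the endpoint 1 are two-sided; as
     G n is analytic at 1, they agree with the one-sided ones. *)
definition multiple_Gamma_functions :: "(nat \<Rightarrow> complex \<Rightarrow> complex) \<Rightarrow> bool" where
  "multiple_Gamma_functions G \<longleftrightarrow>
     (\<forall>z. G 0 z = z) \<and>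
     (\<forall>n\<ge>1.
        G n nicely_meromorphic_on UNIV \<and>
        (\<forall>\<^sub>\<approx>z. G n (z + 1) = G (n - 1) z * G n z) \<and>
        G n 1 = 1 \<and>
        (\<forall>x::real. x \<ge> 1 \<longrightarrow>
           G n (of_real x) \<in> \<real> \<and> Re (G n (of_real x)) > 0 \<and>
           (\<forall>m. (deriv ^^ m) (\<lambda>u::real. Re (G n (of_real u))) differentiable (at x)) \<and>
           (deriv ^^ (n + 1)) (\<lambda>u::real. ln (Re (G n (of_real u)))) x \<ge> 0))"

definition is_principal_log_branch :: "(complex \<Rightarrow> complex) \<Rightarrow> (complex \<Rightarrow> complex) \<Rightarrow> bool" where
  "is_principal_log_branch f L \<longleftrightarrow>
     L holomorphic_on (- \<real>\<^sub>\<le>\<^sub>0) \<and>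
     (\<forall>z. z \<notin> \<real>\<^sub>\<le>\<^sub>0 \<longrightarrow> exp (L z) = f z) \<and>
     (\<forall>x::real. x > 0 \<longrightarrow> L (of_real x) \<in> \<real>)"

end

theory Submission
  imports Defs
begin

text \<open>
  The imaginary part of \<open>log G\<^sub>n\<close> is carried across \<open>0, -1, -2, ...\<close> by the functional equation.
  Write \<open>L\<^sub>n\<close> for the branch of \<open>log G\<^sub>n\<close> on the slit plane.
  Taking logarithms in \<open>G\<^sub>n (z + 1) = G\<^sub>n\<^sub>-\<^sub>1 z * G\<^sub>n z\<close> gives
  \<open>L\<^sub>n z = L\<^sub>n (z + 1) - L\<^sub>n\<^sub>-\<^sub>1 z\<close>, without any ambiguity modulo \<open>2\<pi>\<i>\<close>, because all three
  functions are real on the positive axis.  In fact this identity can be used to define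
  \<open>L\<^sub>n\<^sub>-\<^sub>1\<close>: the existence of a branch for \<open>G\<^sub>n\<close> yields branches for all lower orders
  (\<open>principal_log_branch_shift_diff\<close>), and at order \<open>0\<close> the branch is \<open>Ln\<close>
  (\<open>principal_log_branch_ident\<close>).

  Let \<open>z\<close> tend to \<open>t \<in> (-k, -k+1)\<close> from above, and let \<open>\<pi> c\<^sub>n\<^sub>,\<^sub>k\<close> be the limit of
  the imaginary part of \<open>L\<^sub>n z\<close>.  For \<open>n = 0\<close> it is \<open>\<pi>\<close>.  For \<open>k = 0\<close>, \<open>n \<ge> 1\<close> the
  point \<open>t\<close> lies on the positive axis, where \<open>L\<^sub>n\<close> is continuous and real, so the limit is \<open>0\<close>.
  The identity above gives \<open>c\<^sub>n\<^sub>,\<^sub>k = c\<^sub>n\<^sub>,\<^sub>k\<^sub>-\<^sub>1 - c\<^sub>n\<^sub>-\<^sub>1\<^sub>,\<^sub>k\<close>, which up to the sign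
  \<open>(-1)\<^sup>n\<close> is Pascal's rule for \<open>(k)\<^sub>n / n!\<close>.  This is the double induction in
  \<open>principal_log_branch_boundary_limit\<close>.

  That induction only tells that the limit of the real part exists.  Its value follows afterwards:
  exponentiating, \<open>G\<^sub>n\<close> has a finite nonzero limit as \<open>z \<rightarrow> t\<close> from above, so \<open>t\<close> is not a
  pole and the limit is \<open>G\<^sub>n t\<close> (\<open>nicely_meromorphic_value_eq_limit_within\<close>).
\<close>

text \<open>
  A one-sided finite limit already excludes a pole, since at a pole the function tends to infinity
  from every direction.
\<close>
lemma nicely_meromorphic_value_eq_limit_within:
  assumes "f nicely_meromorphic_on UNIV" "(f \<longlongrightarrow> c) (at z within A)" "at z within A \<noteq> bot"
  shows "f z = c"
proof (cases "is_pole f z")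
  case True
  then have "filterlim f at_infinity (at z within A)"
    unfolding is_pole_def by (rule filterlim_mono[OF _ order_refl at_le]) simp
  with assms(2,3) show ?thesis
    using not_tendsto_and_filterlim_at_infinity by blast
next
  case False
  then have "f \<midarrow>z\<rightarrow> f z"
    using assms(1) is_pole_cong unfolding nicely_meromorphic_on_def by blast
  then have "(f \<longlongrightarrow> f z) (at z within A)"
    by (rule tendsto_within_subset) simp
  with assms(2,3) show ?thesis
    using tendsto_unique by blast
qed

text \<open>
  Branches of the logarithm descend from order \<open>n + 1\<close> to order \<open>n\<close>; in particular \<open>G n\<close> has
  neither zeros nor poles off the cut.
\<close>
lemma principal_log_branch_shift_diff:
  assumes G: "multiple_Gamma_functions G"
    and L: "is_principal_log_branch (G (Suc n)) L"
  shows "is_principal_log_branch (G n) (\<lambda>z. L (z + 1) - L z)"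
proof -
  have slit: "z + 1 \<notin> \<real>\<^sub>\<le>\<^sub>0" if "z \<notin> \<real>\<^sub>\<le>\<^sub>0" for z :: complex
    using that by (auto simp: complex_nonpos_Reals_iff)
  have hol: "L holomorphic_on - \<real>\<^sub>\<le>\<^sub>0"
    using L by (simp add: is_principal_log_branch_def)
  have expL: "exp (L z) = G (Suc n) z" if "z \<notin> \<real>\<^sub>\<le>\<^sub>0" for z
    using L that by (simp add: is_principal_log_branch_def)
  have "(L \<circ> (\<lambda>z. z + 1)) holomorphic_on - \<real>\<^sub>\<le>\<^sub>0"
    by (rule holomorphic_on_compose_gen[OF _ hol]) (use slit in \<open>auto intro!: holomorphic_intros\<close>)
  then have hol_diff: "(\<lambda>z. L (z + 1) - L z) holomorphic_on - \<real>\<^sub>\<le>\<^sub>0"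
    using hol by (auto intro!: holomorphic_intros simp: o_def)
  have mero: "G n nicely_meromorphic_on UNIV"
  proof (cases n)
    case 0
    then have "G n = (\<lambda>z. z)"
      using G by (auto simp: multiple_Gamma_functions_def)
    then show ?thesis
      by (auto intro!: analytic_on_imp_nicely_meromorphic_on analytic_intros)
  next
    case (Suc m)
    then show ?thesis
      using G by (simp add: multiple_Gamma_functions_def)
  qed
  \<comment> \<open>The functional equation may fail at isolated points, so the identity is first obtained
      near \<open>z\<close> and then at \<open>z\<close> by continuity.\<close>
  have "exp (L (z + 1) - L z) = G n z" if z: "z \<notin> \<real>\<^sub>\<le>\<^sub>0" for z
  proof -
    have "\<forall>\<^sub>\<approx>z. G (Suc n) (z + 1) = G n z * G (Suc n) z"
      using G unfolding multiple_Gamma_functions_def by (metis diff_Suc_1 le_add1 plus_1_eq_Suc)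
    then have eq: "\<forall>\<^sub>F w in at z. G (Suc n) (w + 1) = G n w * G (Suc n) w"
      by (rule eventually_cosparse_imp_eventually_at) simp
    have "open (- \<real>\<^sub>\<le>\<^sub>0 :: complex set)"
      by (simp add: open_Compl)
    then have near: "\<forall>\<^sub>F w in at z. w \<in> - \<real>\<^sub>\<le>\<^sub>0"
      using z by (intro eventually_at_in_open') auto
    have "\<forall>\<^sub>F w in at z. exp (L (w + 1) - L w) = G n w"
      using eq near
    proof eventually_elim
      case (elim w)
      have "G (Suc n) w \<noteq> 0"
        using expL[of w] elim(2) by (metis ComplD exp_not_eq_zero)
      then show ?case
        using elim expL[of w] expL[of "w + 1"] slit[of w] by (simp add: exp_diff)
    qed
    moreover have "((\<lambda>w. exp (L (w + 1) - L w)) \<longlongrightarrow> exp (L (z + 1) - L z)) (at z)"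
    proof -
      have "continuous_on (- \<real>\<^sub>\<le>\<^sub>0) (\<lambda>w. L (w + 1) - L w)"
        by (rule holomorphic_on_imp_continuous_on[OF hol_diff])
      then have "isCont (\<lambda>w. L (w + 1) - L w) z"
        using z \<open>open (- \<real>\<^sub>\<le>\<^sub>0)\<close> by (auto simp: continuous_on_eq_continuous_at)
      then show ?thesis
        by (intro tendsto_exp) (simp add: isCont_def)
    qed
    ultimately have "(G n \<longlongrightarrow> exp (L (z + 1) - L z)) (at z)"
      by (rule Lim_transform_eventually[rotated])
    then show ?thesis
      using nicely_meromorphic_value_eq_limit_within[OF mero, of _ z UNIV] by simp
  qed
  moreover have "L (of_real x + 1) - L (of_real x) \<in> \<real>" if "x > 0" for x :: real
  proof -
    have "L (of_real (x + 1)) \<in> \<real>" "L (of_real x) \<in> \<real>"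
      using L that unfolding is_principal_log_branch_def by (simp_all del: of_real_add)
    then show ?thesis by simp
  qed
  ultimately show ?thesis
    using hol_diff by (simp add: is_principal_log_branch_def)
qed

text \<open>
  Two logarithms of the same function have equal derivatives, so on the connected slit plane they
  differ by a constant, which reality at \<open>1\<close> forces to be \<open>0\<close>.
\<close>
lemma principal_log_branch_ident:
  assumes L: "is_principal_log_branch (\<lambda>z. z) L" and z: "z \<notin> \<real>\<^sub>\<le>\<^sub>0"
  shows "L z = Ln z"
proof -
  have hol: "L holomorphic_on - \<real>\<^sub>\<le>\<^sub>0"
    using L by (simp add: is_principal_log_branch_def)
  have expL: "exp (L w) = w" if "w \<notin> \<real>\<^sub>\<le>\<^sub>0" for w
    using L that by (simp add: is_principal_log_branch_def)
  have op: "open (- \<real>\<^sub>\<le>\<^sub>0 :: complex set)"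
    by (simp add: open_Compl)
  have real: "L (of_real x) = Ln (of_real x)" if "x > 0" for x :: real
  proof -
    have "L (of_real x) \<in> \<real>"
      using L that by (simp add: is_principal_log_branch_def)
    then have "Im (L (of_real x)) = 0"
      by (simp add: complex_is_Real_iff)
    moreover have "exp (L (of_real x)) = of_real x"
      using that by (intro expL) (auto simp: complex_nonpos_Reals_iff)
    ultimately show ?thesis
      using Ln_exp[of "L (of_real x)"] by simp
  qed
  have "- \<real>\<^sub>\<le>\<^sub>0 = - (complex_of_real ` {..0})"
    by (auto simp: nonpos_Reals_def)
  then have conn: "connected (- \<real>\<^sub>\<le>\<^sub>0 :: complex set)"
    using starlike_imp_connected[OF starlike_slotted_complex_plane_left[of 0]] by simp
  have "((\<lambda>w. L w - Ln w) has_field_derivative 0) (at w)" if w: "w \<in> - \<real>\<^sub>\<le>\<^sub>0" for w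
  proof -
    have "w \<noteq> 0"
      using w by auto
    have L': "(L has_field_derivative deriv L w) (at w)"
      by (rule holomorphic_derivI[OF hol op w])
    then have "((\<lambda>u. exp (L u)) has_field_derivative exp (L w) * deriv L w) (at w)"
      by (auto intro!: derivative_eq_intros)
    moreover have "((\<lambda>u. exp (L u)) has_field_derivative 1) (at w)"
      by (rule has_field_derivative_transform_within_open[OF DERIV_ident op w]) (simp add: expL)
    ultimately have "w * deriv L w = 1"
      using DERIV_unique expL w by fastforce
    then have "deriv L w = inverse w"
      by (simp add: inverse_unique)
    moreover have "(Ln has_field_derivative inverse w) (at w)"
      using w by (intro has_field_derivative_Ln) simp
    ultimately show ?thesis
      using DERIV_diff[OF L'] by fastforce
  qed
  then have "(\<lambda>w. L w - Ln w) constant_on - \<real>\<^sub>\<le>\<^sub>0"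
    by (rule has_field_derivative_0_imp_constant_on[OF _ conn op])
  moreover have "1 \<in> - (\<real>\<^sub>\<le>\<^sub>0 :: complex set)"
    by (simp add: complex_nonpos_Reals_iff)
  ultimately have "L z - Ln z = L 1 - Ln 1"
    using z unfolding constant_on_def by (elim exE) (metis ComplI)
  with real[of 1] show ?thesis by simp
qed

text \<open>
  The case \<open>k = 0\<close> is admitted for \<open>n \<ge> 1\<close> because it starts the induction on \<open>k\<close>; for
  \<open>k = n = 0\<close> the formula would give the value \<open>\<pi>\<close> for the argument of a positive number.
\<close>
lemma principal_log_branch_boundary_limit:
  assumes G: "multiple_Gamma_functions G"
    and "is_principal_log_branch (G n) L" and "k \<ge> 1 \<or> n \<ge> 1"
    and "t \<in> {- real k <..< - real k + 1}"
  shows "\<exists>r::real. (L \<longlongrightarrow> of_real r + \<i> * of_real ((-1) ^ n * pi * (pochhammer (real k) n / fact n)))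
           (at (of_real t) within {z. Im z > 0})"
  using assms(2-)
proof (induction n arbitrary: L k t)
  case 0
  have "G 0 = (\<lambda>z. z)"
    using G by (auto simp: multiple_Gamma_functions_def)
  then have LLn: "L z = Ln z" if "Im z > 0" for z
    using principal_log_branch_ident[of L z] 0(1) that by (auto simp: complex_nonpos_Reals_iff)
  \<comment> \<open>\<open>Ln\<close> itself jumps at \<open>t\<close>, but above the cut it equals \<open>Ln (- z) + \<i> \<pi>\<close>, which is
      continuous there.\<close>
  have "t < 0"
    using 0(2,3) by auto
  then have "((\<lambda>z. Ln (- z) + \<i> * of_real pi) \<longlongrightarrow> Ln (- of_real t) + \<i> * of_real pi)
      (at (of_real t) within {z. Im z > 0})"
    by (intro tendsto_intros) (auto simp: complex_nonpos_Reals_iff)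
  moreover have "\<forall>\<^sub>F z in at (of_real t) within {z. Im z > 0}. Ln (- z) + \<i> * of_real pi = L z"
    unfolding eventually_at_filter
  proof (intro always_eventually allI impI)
    fix z :: complex assume "z \<in> {z. Im z > 0}"
    then have "Im z > 0" by simp
    moreover from this have "z \<noteq> 0" by auto
    ultimately show "Ln (- z) + \<i> * of_real pi = L z"
      using Ln_minus[of z] LLn[of z] by simp
  qed
  ultimately have "(L \<longlongrightarrow> Ln (- of_real t) + \<i> * of_real pi)
      (at (of_real t) within {z. Im z > 0})"
    by (rule Lim_transform_eventually)
  moreover have "Ln (- of_real t) = of_real (ln (- t))"
    using \<open>t < 0\<close> Ln_of_real[of "- t"] by simp
  ultimately show ?case
    by auto
next
  case (Suc n)
  note IH = Suc.IH
  define M where "M = (\<lambda>z. L (z + 1) - L z)"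
  have M: "is_principal_log_branch (G n) M"
    unfolding M_def by (rule principal_log_branch_shift_diff[OF G Suc.prems(1)])
  show ?case
    using Suc.prems(3)
  proof (induction k arbitrary: t)
    case 0
    then have t: "t > 0" by simp
    have hol: "L holomorphic_on - \<real>\<^sub>\<le>\<^sub>0"
      using Suc.prems by (simp add: is_principal_log_branch_def)
    have "isCont L (of_real t)"
      using holomorphic_on_imp_continuous_on[OF hol] t
      by (auto simp: continuous_on_eq_continuous_at open_Compl complex_nonpos_Reals_iff)
    then have "(L \<longlongrightarrow> L (of_real t)) (at (of_real t) within {z. Im z > 0})"
      unfolding isCont_def by (rule tendsto_within_subset) simp
    moreover have "L (of_real t) \<in> \<real>"
      using Suc.prems t by (simp add: is_principal_log_branch_def)
    then obtain r where "L (of_real t) = of_real r"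
      by (rule Reals_cases)
    ultimately show ?case
      by (intro exI[of _ r]) (simp add: pochhammer_rec)
  next
    case (Suc k)
    let ?F = "at (of_real t :: complex) within {z. Im z > 0}"
    obtain r where r: "(L \<longlongrightarrow> of_real r + \<i> * of_real ((-1) ^ Suc n * pi *
        (pochhammer (real k) (Suc n) / fact (Suc n)))) (at (of_real (t + 1)) within {z. Im z > 0})"
      using Suc.IH[of "t + 1"] Suc.prems by auto
    obtain s where s: "(M \<longlongrightarrow> of_real s + \<i> * of_real ((-1) ^ n * pi *
        (pochhammer (real (Suc k)) n / fact n))) ?F"
      using IH[OF M, of "Suc k" t] Suc.prems by auto
    have "filterlim (\<lambda>z. z + 1) (at (of_real (t + 1)) within {z. Im z > 0}) ?F"
      unfolding filterlim_at
      by (auto intro!: tendsto_eq_intros simp: eventually_at_filter)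
    from tendsto_diff[OF filterlim_compose[OF r this] s]
    have lim: "(L \<longlongrightarrow> (of_real r + \<i> * of_real ((-1) ^ Suc n * pi *
          (pochhammer (real k) (Suc n) / fact (Suc n)))) -
        (of_real s + \<i> * of_real ((-1) ^ n * pi * (pochhammer (real (Suc k)) n / fact n)))) ?F"
      by (simp add: M_def)
    \<comment> \<open>Pascal's rule for \<open>(k)\<^sub>n\<^sub>+\<^sub>1 / (n + 1)!\<close>, with the common factor \<open>P = (k + 1)\<^sub>n\<close>
        of the three Pochhammer symbols abstracted.\<close>
    have pascal: "a * P / ((N + 1) * F) + P / F = (a + 1 + N) * P / ((N + 1) * F)"
      if "F > 0" "N \<ge> 0" for a P N F :: real
    proof -
      have "P / F = (N + 1) * P / ((N + 1) * F)"
        using that by simp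
      then show ?thesis
        by (simp add: algebra_simps flip: add_divide_distrib)
    qed
    have "pochhammer (real k) (Suc n) / fact (Suc n) + pochhammer (real (Suc k)) n / fact n =
        pochhammer (real (Suc k)) (Suc n) / fact (Suc n)"
      unfolding pochhammer_rec[of "real k"] pochhammer_rec'[of "real (Suc k)"]
      using pascal[of "fact n" "real n" "real k" "pochhammer (real k + 1) n"]
      by (simp add: add_ac)
    from arg_cong[OF this, of "\<lambda>x. (-1) ^ Suc n * pi * x"]
    have "(-1) ^ Suc n * pi * (pochhammer (real k) (Suc n) / fact (Suc n)) -
        (-1) ^ n * pi * (pochhammer (real (Suc k)) n / fact n) =
        (-1) ^ Suc n * pi * (pochhammer (real (Suc k)) (Suc n) / fact (Suc n))"
      unfolding distrib_left by simp
    from arg_cong[OF this, of "\<lambda>x. of_real (r - s) + \<i> * of_real x"]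
    have "(of_real r + \<i> * of_real ((-1) ^ Suc n * pi *
          (pochhammer (real k) (Suc n) / fact (Suc n)))) -
        (of_real s + \<i> * of_real ((-1) ^ n * pi * (pochhammer (real (Suc k)) n / fact n))) =
      of_real (r - s) + \<i> * of_real ((-1) ^ Suc n * pi *
          (pochhammer (real (Suc k)) (Suc n) / fact (Suc n)))"
      by (simp only: of_real_diff right_diff_distrib) (simp only: diff_conv_add_uminus minus_add_distrib add_ac)
    with lim show ?case by (intro exI[of _ "r - s"]) (simp only:)
  qed
qed

theorem proposition1:
  fixes G :: "nat \<Rightarrow> complex \<Rightarrow> complex" and logG :: "complex \<Rightarrow> complex"
    and k n :: nat and t :: real
  assumes "multiple_Gamma_functions G"
    and "k \<ge> 1" and "n \<ge> 1"
    and "is_principal_log_branch (G n) logG"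
    and "t \<in> {- real k <..< - real k + 1}"
  shows "(logG \<longlongrightarrow>
           of_real (ln (cmod (G n (of_real t)))) +
           \<i> * of_real ((-1) ^ n * pi * (pochhammer (real k) n / fact n)))
         (at (of_real t) within {z. Im z > 0})"
proof -
  let ?F = "at (of_real t :: complex) within {z. Im z > 0}"
  let ?\<theta> = "(-1) ^ n * pi * (pochhammer (real k) n / fact n)"
  obtain r :: real where r: "(logG \<longlongrightarrow> of_real r + \<i> * of_real ?\<theta>) ?F"
    using principal_log_branch_boundary_limit[OF assms(1,4)] assms(2,5) by blast
  have "\<forall>\<^sub>F z in ?F. exp (logG z) = G n z"
    using assms(4)
    by (auto simp: eventually_at_filter is_principal_log_branch_def complex_nonpos_Reals_iff)
  with tendsto_exp[OF r] have "(G n \<longlongrightarrow> exp (of_real r + \<i> * of_real ?\<theta>)) ?F"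
    by (rule Lim_transform_eventually)
  moreover have "?F \<noteq> bot"
  proof -
    have "\<exists>z\<in>{z. Im z > 0}. z \<noteq> of_real t \<and> dist z (of_real t) < e" if "e > 0" for e
      using that by (intro bexI[of _ "of_real t + of_real (e / 2) * \<i>"]) (auto simp: dist_norm norm_mult)
    then have "complex_of_real t islimpt {z. Im z > 0}"
      by (simp add: islimpt_approachable)
    then show ?thesis
      by (simp add: trivial_limit_within)
  qed
  moreover have "G n nicely_meromorphic_on UNIV"
    using assms(1,3) by (simp add: multiple_Gamma_functions_def)
  ultimately have "G n (of_real t) = exp (of_real r + \<i> * of_real ?\<theta>)"
    by (intro nicely_meromorphic_value_eq_limit_within)
  then have "ln (cmod (G n (of_real t))) = r"
    by (simp del: of_real_mult of_real_divide)
  with r show ?thesis by simp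
qed

end
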